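(* Let $d\in\mathbb N$, $a\in\mathbb N_0$, and for $n\in\mathbb N_0$ let $$B(d,a;n):=\sum_{m=0}^n(-1)^m\,\frac{1}{m+1}\,S2(d,a;n,m)\,m!.$$ Then, as formal power series in $t$, $$\sum_{n=0}^{\infty}B(d,a;n)\,\frac{t^n}{n!}=\frac{d\,t\,e^{a\,t}}{e^{d\,t}-1}.$$
   Context: $\mathbb N=\{1,2,\dots\}$, $\mathbb N_0=\{0,1,2,\dots\}$. The generalized Stirling numbers of the second kind $S2(d,a;n,m)$, $0\le m\le n$, are defined by the operator identity $(a\,\mathbf 1+d\,\mathbf E_x)^n=\sum_{m=0}^n S2(d,a;n,m)\,x^m\,\mathbf d_x^{\,m}$, where $\mathbf d_x$ is differentiation with respect to $x$, $\mathbf E_x:=x\,\mathbf d_x$ and $\mathbf 1$ is the identity operator. *)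

theory Defs
  imports "HOL-Computational_Algebra.Computational_Algebra"
begin

text \<open>Operators act on the real polynomials in \<open>x\<close>, on which composites of \<open>x\<close> and
  \<open>d/dx\<close> are faithfully represented.\<close>

definition euler_op :: "real poly \<Rightarrow> real poly" where
  "euler_op p = [:0, 1:] * pderiv p"

definition affine_euler_op :: "nat \<Rightarrow> nat \<Rightarrow> real poly \<Rightarrow> real poly" where
  "affine_euler_op d a p = smult (real a) p + smult (real d) (euler_op p)"

definition is_S2_row :: "nat \<Rightarrow> nat \<Rightarrow> nat \<Rightarrow> (nat \<Rightarrow> real) \<Rightarrow> bool" where
  "is_S2_row d a n s \<longleftrightarrow>
     (\<forall>m>n. s m = 0) \<and>
     (\<forall>p. (affine_euler_op d a ^^ n) p = (\<Sum>m\<le>n. smult (s m) (monom 1 m * (pderiv ^^ m) p)))"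

text \<open>The value for \<open>m > n\<close>, where the mathematical definition is silent, is \<open>0\<close>.\<close>

definition S2 :: "nat \<Rightarrow> nat \<Rightarrow> nat \<Rightarrow> nat \<Rightarrow> real" where
  "S2 d a n = (THE s. is_S2_row d a n s)"

definition gen_bernoulli :: "nat \<Rightarrow> nat \<Rightarrow> nat \<Rightarrow> real" where
  "gen_bernoulli d a n = (\<Sum>m=0..n. (-1) ^ m * (1 / real (m + 1)) * S2 d a n m * fact m)"

text \<open>The operator identity determines the row of coefficients uniquely, so the description
  above is proper.\<close>

lemma coeff_monom_pderiv_iter:
  "coeff (monom 1 m * (pderiv ^^ m) (monom 1 k)) k =
     (if m \<le> k then pochhammer (real (k - m + 1)) m else 0)"
proof -
  have *: "coeff ((pderiv ^^ m) p) j = pochhammer (real (j + 1)) m * coeff p (j + m)"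
    for p :: "real poly" and j
    by (induction m arbitrary: p j)
       (auto simp: coeff_pderiv pochhammer_rec algebra_simps)
  show ?thesis
    by (simp add: coeff_monom_mult * coeff_monom)
qed

lemma is_S2_row_unique:
  assumes "is_S2_row d a n s" "is_S2_row d a n t"
  shows "s = t"
proof
  fix k show "s k = t k"
  proof (induction k rule: less_induct)
    case (less k)
    show ?case
    proof (cases "k \<le> n")
      case False
      then show ?thesis using assms by (simp add: is_S2_row_def)
    next
      case True
      let ?c = "\<lambda>m. coeff (monom 1 m * (pderiv ^^ m) (monom 1 k)) k :: real"
      have "(\<Sum>m\<le>n. smult (s m) (monom 1 m * (pderiv ^^ m) (monom 1 k)))
          = (\<Sum>m\<le>n. smult (t m) (monom 1 m * (pderiv ^^ m) (monom 1 k)))"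
        using assms unfolding is_S2_row_def by metis
      then have "(\<Sum>m\<le>n. s m * ?c m) = (\<Sum>m\<le>n. t m * ?c m)"
        by (auto dest: arg_cong[where f = "\<lambda>q. coeff q k"] simp: coeff_sum)
      then have "(\<Sum>m\<le>n. (s m - t m) * ?c m) = 0"
        by (simp add: left_diff_distrib sum_subtractf)
      also have "(\<Sum>m\<le>n. (s m - t m) * ?c m) = (\<Sum>m\<in>{k}. (s m - t m) * ?c m)"
        using True less by (intro sum.mono_neutral_right) (auto simp: coeff_monom_pderiv_iter)
      finally have "(s k - t k) * ?c k = 0" by simp
      moreover have "?c k \<noteq> 0"
        by (simp add: coeff_monom_pderiv_iter pochhammer_fact[symmetric])
      ultimately show ?thesis by simp
    qed
  qed
qed

lemma is_S2_row_exists: "\<exists>s. is_S2_row d a n s"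
proof (induction n)
  case 0
  have "is_S2_row d a 0 (\<lambda>m. if m = 0 then 1 else 0)"
    by (simp add: is_S2_row_def)
  then show ?case by blast
next
  case (Suc n)
  then obtain s where s0: "\<And>m. m > n \<Longrightarrow> s m = 0"
    and s: "\<And>p. (affine_euler_op d a ^^ n) p = (\<Sum>m\<le>n. smult (s m) (monom 1 m * (pderiv ^^ m) p))"
    by (auto simp: is_S2_row_def)
  define X where "X m p = monom 1 m * (pderiv ^^ m) p" for m and p :: "real poly"
  define s' where "s' m = (real a + real d * real m) * s m +
      (if m = 0 then 0 else real d * s (m - 1))" for m
  have E: "euler_op (X m p) = smult (real m) (X m p) + X (Suc m) p" for m p
  proof -
    have "[:0, 1:] * pderiv (monom 1 m) = smult (real m) (monom 1 m)"
      by (cases m) (simp_all add: pderiv_monom smult_monom flip: monom_Suc)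
    then have "[:0, 1:] * (pderiv (monom 1 m) * q) = smult (real m) (monom 1 m * q)"
      for q :: "real poly"
      by (metis mult.assoc mult_smult_left)
    moreover have "[:0, 1:] * (monom 1 m * q) = monom 1 (Suc m) * q" for q :: "real poly"
      by (simp add: monom_Suc)
    ultimately show ?thesis
      by (simp only: euler_op_def X_def pderiv_mult distrib_left funpow.simps comp_apply
          mult.commute[of "(pderiv ^^ m) p"] add.commute)
  qed
  have A: "affine_euler_op d a (X m p)
      = smult (real a + real d * real m) (X m p) + smult (real d) (X (Suc m) p)" for m p
    by (simp add: affine_euler_op_def E smult_add_left smult_add_right)
  have add: "affine_euler_op d a (p + q) = affine_euler_op d a p + affine_euler_op d a q" for p q
    by (simp only: affine_euler_op_def euler_op_def pderiv_add distrib_left smult_add_right add_ac)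
  have scale: "affine_euler_op d a (smult c p) = smult c (affine_euler_op d a p)" for c p
    by (simp add: affine_euler_op_def euler_op_def pderiv_smult smult_add_right mult.commute)
  have zero: "affine_euler_op d a 0 = 0"
    by (simp add: affine_euler_op_def euler_op_def)
  have lin: "affine_euler_op d a (\<Sum>m\<in>M. smult (f m) (g m)) =
      (\<Sum>m\<in>M. smult (f m) (affine_euler_op d a (g m)))" if "finite M" for M :: "nat set" and f g
    using that by induction (simp_all add: zero add scale)
  have "(affine_euler_op d a ^^ Suc n) p = (\<Sum>m\<le>Suc n. smult (s' m) (X m p))" for p
  proof -
    have "(affine_euler_op d a ^^ Suc n) p =
        (\<Sum>m\<le>n. smult ((real a + real d * real m) * s m) (X m p)) +
        (\<Sum>m\<le>n. smult (real d * s m) (X (Suc m) p))"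
      by (simp add: s lin A smult_add_right sum.distrib mult.commute flip: X_def)
    also have "(\<Sum>m\<le>n. smult ((real a + real d * real m) * s m) (X m p)) =
        (\<Sum>m\<le>Suc n. smult ((real a + real d * real m) * s m) (X m p))"
      by (simp add: s0)
    also have "(\<Sum>m\<le>n. smult (real d * s m) (X (Suc m) p)) =
        (\<Sum>m\<le>Suc n. smult (if m = 0 then 0 else real d * s (m - 1)) (X m p))"
      by (simp add: sum.atMost_Suc_shift del: sum.atMost_Suc)
    finally show ?thesis
      by (simp only: s'_def smult_add_left sum.distrib)
  qed
  moreover have "s' m = 0" if "m > Suc n" for m
    using that by (simp add: s'_def s0)
  ultimately have "is_S2_row d a (Suc n) s'"
    by (simp add: is_S2_row_def X_def del: sum.atMost_Suc funpow.simps)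
  then show ?case by blast
qed

lemma is_S2_row_S2: "is_S2_row d a n (S2 d a n)"
  unfolding S2_def by (metis is_S2_row_exists is_S2_row_unique theI)

text \<open>The series \<open>exp(dt) - 1\<close> has no constant term, hence no inverse; quotients of series with
  numerator a multiple of \<open>t\<close> are nevertheless exact.\<close>

lemma fps_exp_minus_one_dvd:
  assumes "d \<ge> 1"
  shows "(fps_exp (real d) - 1) dvd (fps_const (real d) * fps_X * f)"
proof (cases "f = 0")
  case False
  have "subdegree (fps_exp (real d) - 1) = 1"
    using assms by (intro subdegreeI) auto
  moreover have "fps_exp (real d) - 1 \<noteq> 0" "fps_const (real d) * fps_X * f \<noteq> 0"
    using assms False calculation by auto
  ultimately show ?thesis
    using assms False by (simp add: fps_dvd_iff mult.assoc)
qed simp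

end

theory Submission
  imports Defs
begin

text \<open>Comparing the coefficients of \<open>x\<^sup>k\<close> in the operator identity applied to \<open>x\<^sup>k\<close> gives
  \<open>(a + d k)\<^sup>n = (\<Sum>m. binom(k, m) S2(d,a;n,m) m!)\<close> for all \<open>k\<close>. The same triangular system arises
  from the binomial expansion of \<open>e\<^bsup>at\<^esup> (1 + u)\<^sup>k\<close> with \<open>u = e\<^bsup>dt\<^esup> - 1\<close>, so \<open>e\<^bsup>at\<^esup> u\<^sup>m\<close> is the
  exponential generating function of \<open>S2(d,a;n,m) m!\<close>. Summing over \<open>m\<close> with the weights
  \<open>(-1)\<^sup>m / (m + 1)\<close> yields \<open>e\<^bsup>at\<^esup> ln(1 + u) / u\<close>, and \<open>ln(1 + u) = dt\<close>.\<close>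

text \<open>The system is triangular with diagonal entries \<open>m choose m = 1\<close>: once the
  earlier terms agree, the equation for \<open>k = m\<close> isolates the last one.\<close>

lemma binomial_transform_inject:
  fixes f g :: "nat \<Rightarrow> real"
  assumes "\<And>k. (\<Sum>m\<le>k. real (k choose m) * f m) = (\<Sum>m\<le>k. real (k choose m) * g m)"
  shows "f m = g m"
proof (induction m rule: less_induct)
  case (less m)
  have "(\<Sum>j<m. real (m choose j) * f j) = (\<Sum>j<m. real (m choose j) * g j)"
    using less by (intro sum.cong) auto
  then show ?case
    using assms[of m] by (simp add: lessThan_Suc_atMost[symmetric])
qed

text \<open>Each monomial is an eigenvector of the operator, since \<open>x * d/dx\<close>
  multiplies \<open>x^k\<close> by \<open>k\<close>.\<close>

lemma affine_euler_op_iter_monom: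
  "(affine_euler_op d a ^^ n) (monom 1 k) = monom ((real a + real d * real k) ^ n) k"
proof (induction n)
  case (Suc n)
  have "affine_euler_op d a (monom c k) = monom ((real a + real d * real k) * c) k" for c
    by (cases k) (simp_all add: affine_euler_op_def euler_op_def pderiv_monom smult_monom
        add_monom algebra_simps flip: monom_Suc)
  then show ?case by (simp add: Suc)
qed simp

lemma S2_eq_0: "m > n \<Longrightarrow> S2 d a n m = 0"
  using is_S2_row_S2[of d a n] by (simp add: is_S2_row_def)

lemma S2_binomial_transform:
  "(\<Sum>m\<le>k. real (k choose m) * (S2 d a n m * fact m)) = (real a + real d * real k) ^ n"
proof -
  have *: "pochhammer (real (k - m + 1)) m = real (k choose m) * fact m" if "m \<le> k" for m
    using that by (simp add: binomial_gbinomial gbinomial_pochhammer' of_nat_diff algebra_simps)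
  have "(affine_euler_op d a ^^ n) (monom 1 k) =
      (\<Sum>m\<le>n. smult (S2 d a n m) (monom 1 m * (pderiv ^^ m) (monom 1 k)))"
    using is_S2_row_S2[of d a n] by (simp add: is_S2_row_def)
  from arg_cong[OF this, of "\<lambda>q. coeff q k"]
  have "(real a + real d * real k) ^ n =
      (\<Sum>m\<le>n. S2 d a n m * (if m \<le> k then pochhammer (real (k - m + 1)) m else 0))"
    by (simp add: affine_euler_op_iter_monom coeff_sum coeff_monom_pderiv_iter)
  also have "\<dots> = (\<Sum>m\<le>n. real (k choose m) * (S2 d a n m * fact m))"
    by (intro sum.cong refl) (use * in \<open>auto simp: binomial_eq_0 simp del: of_nat_diff\<close>)
  \<comment> \<open>The range passes from \<open>m \<le> n\<close> to \<open>m \<le> k\<close>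
    through a common bound: \<open>S2\<close> vanishes above \<open>n\<close>, the binomial
    coefficient above \<open>k\<close>.\<close>
  also have "\<dots> = (\<Sum>m\<le>max n k. real (k choose m) * (S2 d a n m * fact m))"
    by (intro sum.mono_neutral_left) (auto simp: S2_eq_0)
  also have "\<dots> = (\<Sum>m\<le>k. real (k choose m) * (S2 d a n m * fact m))"
    by (intro sum.mono_neutral_right) (auto simp: binomial_eq_0)
  finally show ?thesis by simp
qed

lemma S2_egf:
  "S2 d a n m * fact m = fact n * (fps_exp (real a) * (fps_exp (real d) - 1) ^ m) $ n"
\<comment> \<open>Here \<open>n\<close> is fixed and \<open>m\<close> runs; both sequences have
  binomial transform \<open>(a + d k)^n\<close>.\<close>
proof (rule binomial_transform_inject[where m = m
      and f = "\<lambda>m. S2 d a n m * fact m"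
      and g = "\<lambda>m. fact n * (fps_exp (real a) * (fps_exp (real d) - 1) ^ m) $ n"])
  fix k
  let ?u = "fps_exp (real d) - 1 :: real fps"
  have "fps_exp (real a + real k * real d) = fps_exp (real a) * (?u + 1) ^ k"
    by (simp add: fps_exp_add_mult fps_exp_power_mult)
  also have "\<dots> = (\<Sum>m\<le>k. fps_const (real (k choose m)) * (fps_exp (real a) * ?u ^ m))"
    unfolding binomial_ring by (simp add: sum_distrib_left fps_of_nat mult_ac)
  finally have "fps_exp (real a + real k * real d) $ n =
      (\<Sum>m\<le>k. real (k choose m) * (fps_exp (real a) * ?u ^ m) $ n)"
    by (simp add: fps_sum_nth)
  from arg_cong[OF this, of "\<lambda>y. fact n * y"]
  have "(real a + real k * real d) ^ n =
      (\<Sum>m\<le>k. real (k choose m) * (fact n * (fps_exp (real a) * ?u ^ m) $ n))"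
    by (simp add: sum_distrib_left mult_ac)
  then show "(\<Sum>m\<le>k. real (k choose m) * (S2 d a n m * fact m)) =
      (\<Sum>m\<le>k. real (k choose m) * (fact n * (fps_exp (real a) * ?u ^ m) $ n))"
    by (simp only: S2_binomial_transform mult.commute[of "real d"])
qed

text \<open>As \<open>u\<close> has no constant term, \<open>u ^ i\<close> has no terms below degree
  \<open>i\<close>. All coefficients of \<open>f oo u\<close> up to degree \<open>n\<close> can thus
  share the bound \<open>i \<le> n\<close>, and the two sums can be swapped.\<close>

lemma fps_mult_compose_nth:
  fixes f g u :: "'a::comm_ring_1 fps"
  assumes "u $ 0 = 0"
  shows "(g * (f oo u)) $ n = (\<Sum>i=0..n. f $ i * (g * u ^ i) $ n)"
proof -
  have "(f oo u) $ j = (\<Sum>i=0..n. f $ i * (u ^ i) $ j)" if "j \<le> n" for j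
    unfolding fps_compose_nth using that assms
    by (intro sum.mono_neutral_left) (auto simp: startsby_zero_power_prefix)
  then have "(g * (f oo u)) $ n = (\<Sum>j=0..n. \<Sum>i=0..n. g $ j * (f $ i * (u ^ i) $ (n - j)))"
    by (simp add: fps_mult_nth sum_distrib_left)
  also have "\<dots> = (\<Sum>i=0..n. f $ i * (g * u ^ i) $ n)"
    by (subst sum.swap) (simp add: fps_mult_nth sum_distrib_left mult_ac)
  finally show ?thesis .
qed

theorem mainTheorem14:
  fixes d a :: nat
  assumes "d \<ge> 1"
  shows "Abs_fps (\<lambda>n. gen_bernoulli d a n / fact n) =
           (fps_const (real d) * fps_X * fps_exp (real a)) / (fps_exp (real d) - 1)"
proof -
  let ?u = "fps_exp (real d) - 1 :: real fps"
  \<comment> \<open>This is the series of ln(1 + x) / x.\<close>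
  define f :: "real fps" where "f = Abs_fps (\<lambda>m. (-1) ^ m / real (m + 1))"
  have u0: "?u $ 0 = 0" and u1: "?u $ 1 \<noteq> 0"
    using assms by auto
  \<comment> \<open>\<open>fps_ln c\<close> is ln(1 + x) / c, the compositional inverse of e^(c x) -
    1; the factor \<open>d\<close> cancels this normalisation.\<close>
  have "fps_X * f = fps_const (real d) * fps_ln (real d)"
    using assms by (intro fps_ext) (auto simp: f_def fps_ln_nth)
  then have "(fps_X oo ?u) * (f oo ?u) = (fps_const (real d) * fps_ln (real d)) oo ?u"
    using fps_compose_mult_distrib[OF u0] by metis
  also have "\<dots> = fps_const (real d) * (fps_inv ?u oo ?u)"
    using assms by (simp add: fps_compose_mult_distrib[OF u0] fps_ln_fps_exp_inv)
  also have "\<dots> = fps_const (real d) * fps_X"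
    by (simp only: fps_inv[OF u0 u1])
  finally have "?u * (f oo ?u) = fps_const (real d) * fps_X"
    using u0 by simp
  moreover have "Abs_fps (\<lambda>n. gen_bernoulli d a n / fact n) = fps_exp (real a) * (f oo ?u)"
  proof (rule fps_ext)
    fix n
    have "gen_bernoulli d a n =
        (\<Sum>m=0..n. fact n * (f $ m * (fps_exp (real a) * ?u ^ m) $ n))"
      unfolding gen_bernoulli_def
      by (intro sum.cong refl) (simp add: f_def mult.assoc S2_egf)
    then show "Abs_fps (\<lambda>n. gen_bernoulli d a n / fact n) $ n = (fps_exp (real a) * (f oo ?u)) $ n"
      by (simp add: fps_mult_compose_nth[OF u0] flip: sum_distrib_left)
  qed
  ultimately have "fps_const (real d) * fps_X * fps_exp (real a) =
      Abs_fps (\<lambda>n. gen_bernoulli d a n / fact n) * ?u"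
    by (simp add: mult_ac)
  \<comment> \<open>\<open>?u\<close> is not a unit, but the numerator is now an explicit multiple
    of it, so the division is exact once \<open>?u\<close> is nonzero.\<close>
  moreover have "?u \<noteq> 0"
    using u1 by force
  ultimately show ?thesis by simp
qed

end
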